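(* Let $X$ be a finite set. Two operations $\ast,\star\in\mathcal{M}(X)$ are $\mathcal{L}$-equivalent if and only if $im(T_\ast)=im(T_\star)$ and $diag(T_\ast)=diag(T_\star)$.
   Context: $\mathcal{M}(X)=X^{X\times X}$ is the set of all binary operations on $X$, a monoid under $\triangleright$ defined by $a(\circ\triangleright\ast)b=(a\circ b)\ast(b\circ a)$ for all $a,b\in X$, with identity $a\circ_{lz}b=a$. The left Green's relation $\mathcal{L}$: $\ast\,\mathcal{L}\,\star$ iff $\mathcal{M}(X)\ast=\mathcal{M}(X)\star$, where $\mathcal{M}(X)\ast=\{\circ\triangleright\ast : \circ\in\mathcal{M}(X)\}$. The pairmorph transformation induced by $\ast$ is $T_\ast:X\times X\to X\times X$, $T_\ast(a,b)=(a\ast b,b\ast a)$. With $\Delta(X)=\{(x,x):x\in X\}$, $im(T_\ast)=T_\ast(X\times X)$ and $diag(T_\ast)=T_\ast(\Delta(X))$. *)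

theory Defs
  imports "HOL-Algebra.Group" "HOL-Library.FuncSet"
begin

text \<open>
  A binary operation on a set \<open>X\<close> is an extensional function on the pairs in \<open>X \<times> X\<close>, so that
  equality of HOL functions is equality of operations on \<open>X\<close>.
\<close>

definition binops :: "'a set \<Rightarrow> ('a \<times> 'a \<Rightarrow> 'a) set"
  where "binops X = (X \<times> X) \<rightarrow>\<^sub>E X"

definition op_mult :: "'a set \<Rightarrow> ('a \<times> 'a \<Rightarrow> 'a) \<Rightarrow> ('a \<times> 'a \<Rightarrow> 'a) \<Rightarrow> 'a \<times> 'a \<Rightarrow> 'a"
  where "op_mult X f g = (\<lambda>(a, b)\<in>X \<times> X. g (f (a, b), f (b, a)))"

definition left_zero_op :: "'a set \<Rightarrow> 'a \<times> 'a \<Rightarrow> 'a"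
  where "left_zero_op X = (\<lambda>(a, b)\<in>X \<times> X. a)"

definition binop_monoid :: "'a set \<Rightarrow> ('a \<times> 'a \<Rightarrow> 'a) monoid"
  where "binop_monoid X = \<lparr>carrier = binops X, mult = op_mult X, one = left_zero_op X\<rparr>"

lemma monoid_binop_monoid: "monoid (binop_monoid X)"
proof (rule monoidI)
  fix f g h
  assume fgh: "f \<in> carrier (binop_monoid X)" "g \<in> carrier (binop_monoid X)"
    "h \<in> carrier (binop_monoid X)"
  show "f \<otimes>\<^bsub>binop_monoid X\<^esub> g \<otimes>\<^bsub>binop_monoid X\<^esub> h
      = f \<otimes>\<^bsub>binop_monoid X\<^esub> (g \<otimes>\<^bsub>binop_monoid X\<^esub> h)"
    using fgh by (fastforce simp: binop_monoid_def binops_def op_mult_def fun_eq_iff PiE_iff)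
next
  fix f
  assume f: "f \<in> carrier (binop_monoid X)"
  show "\<one>\<^bsub>binop_monoid X\<^esub> \<otimes>\<^bsub>binop_monoid X\<^esub> f = f"
    using f by (auto simp: binop_monoid_def binops_def op_mult_def left_zero_op_def
        fun_eq_iff PiE_iff extensional_def)
  show "f \<otimes>\<^bsub>binop_monoid X\<^esub> \<one>\<^bsub>binop_monoid X\<^esub> = f"
    using f by (auto simp: binop_monoid_def binops_def op_mult_def left_zero_op_def
        fun_eq_iff PiE_iff extensional_def)
qed (auto simp: binop_monoid_def binops_def op_mult_def left_zero_op_def PiE_iff)

definition principal_left_ideal :: "('a, 'b) monoid_scheme \<Rightarrow> 'a \<Rightarrow> 'a set"
  where "principal_left_ideal M x = {y \<otimes>\<^bsub>M\<^esub> x | y. y \<in> carrier M}"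

definition green_L :: "('a, 'b) monoid_scheme \<Rightarrow> 'a \<Rightarrow> 'a \<Rightarrow> bool"
  where "green_L M x y \<longleftrightarrow> principal_left_ideal M x = principal_left_ideal M y"

text \<open>The map below is only ever evaluated on \<open>X \<times> X\<close>, hence it carries no restriction.\<close>

definition pairmorph :: "('a \<times> 'a \<Rightarrow> 'a) \<Rightarrow> 'a \<times> 'a \<Rightarrow> 'a \<times> 'a"
  where "pairmorph f = (\<lambda>(a, b). (f (a, b), f (b, a)))"

definition pairmorph_im :: "'a set \<Rightarrow> ('a \<times> 'a \<Rightarrow> 'a) \<Rightarrow> ('a \<times> 'a) set"
  where "pairmorph_im X f = pairmorph f ` (X \<times> X)"

definition pairmorph_diag :: "'a set \<Rightarrow> ('a \<times> 'a \<Rightarrow> 'a) \<Rightarrow> ('a \<times> 'a) set"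
  where "pairmorph_diag X f = pairmorph f ` Id_on X"

end

theory Submission
  imports Defs
begin

text \<open>
  Since the transformation of \<open>h \<triangleright> g\<close> is \<open>T\<^sub>g \<circ> T\<^sub>h\<close>, an operation \<open>f\<close> is a left multiple of \<open>g\<close>
  iff \<open>T\<^sub>f\<close> factors as \<open>T\<^sub>g \<circ> T\<^sub>h\<close>. Such an \<open>h\<close> arises by choosing, for every pair \<open>(a, b)\<close>,
  a preimage of \<open>T\<^sub>f (a, b)\<close> under \<open>T\<^sub>g\<close>, diagonal if \<open>a = b\<close>. For the choice to have the form
  \<open>(h (a, b), h (b, a))\<close> it has to commute with swapping coordinates, so it is made freely for only
  one of \<open>(a, b)\<close> and \<open>(b, a)\<close>, the one respecting a fixed total order.
\<close>

text \<open>The unit puts \<open>x\<close> into its own ideal, and associativity absorbs further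
  left factors. This turns a comparison of ideals into the existence of a single left
  factor.\<close>

lemma (in monoid) principal_left_ideal_subset_iff:
  assumes "x \<in> carrier G" and "y \<in> carrier G"
  shows "principal_left_ideal G x \<subseteq> principal_left_ideal G y
    \<longleftrightarrow> x \<in> principal_left_ideal G y"
proof
  assume "principal_left_ideal G x \<subseteq> principal_left_ideal G y"
  moreover have "x \<in> principal_left_ideal G x"
    unfolding principal_left_ideal_def using l_one[OF assms(1), symmetric] one_closed by blast
  ultimately show "x \<in> principal_left_ideal G y" by blast
next
  assume "x \<in> principal_left_ideal G y"
  then obtain z where z: "z \<in> carrier G" "x = z \<otimes> y"
    unfolding principal_left_ideal_def by blast
  have "w \<otimes> x = (w \<otimes> z) \<otimes> y" if "w \<in> carrier G" for w
    using that z assms(2) by (simp add: m_assoc)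
  then show "principal_left_ideal G x \<subseteq> principal_left_ideal G y"
    using z(1) unfolding principal_left_ideal_def by blast
qed

lemma pairmorph_op_mult:
  assumes "p \<in> X \<times> X"
  shows "pairmorph (op_mult X h g) p = pairmorph g (pairmorph h p)"
  using assms by (auto simp: pairmorph_def op_mult_def)

text \<open>The diagonal is preserved since both coordinates of the image of \<open>(a, a)\<close>
  are \<open>h (a, a)\<close>; this is why the diagonal images give a second necessary
  condition.\<close>

lemma pairmorph_in:
  assumes "h \<in> binops X"
  shows "p \<in> X \<times> X \<Longrightarrow> pairmorph h p \<in> X \<times> X"
    and "p \<in> Id_on X \<Longrightarrow> pairmorph h p \<in> Id_on X"
  using assms by (auto simp: pairmorph_def binops_def)

lemma left_multiple_iff:
  assumes f: "f \<in> binops X"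
  shows "(\<exists>h\<in>binops X. f = op_mult X h g) \<longleftrightarrow>
    pairmorph_im X f \<subseteq> pairmorph_im X g \<and> pairmorph_diag X f \<subseteq> pairmorph_diag X g"
proof
  assume "\<exists>h\<in>binops X. f = op_mult X h g"
  then obtain h where h: "h \<in> binops X" and fh: "f = op_mult X h g" by blast
  \<comment> \<open>To be used with \<open>P\<close> as \<open>X \<times> X\<close> and as
    \<open>Id_on X\<close>, which yields both inclusions.\<close>
  have "pairmorph f ` P \<subseteq> pairmorph g ` P"
    if "P \<subseteq> X \<times> X" "\<And>p. p \<in> P \<Longrightarrow> pairmorph h p \<in> P" for P
  proof (rule image_subsetI)
    fix p assume "p \<in> P"
    with that show "pairmorph f p \<in> pairmorph g ` P"
      unfolding fh by (subst pairmorph_op_mult) auto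
  qed
  then show "pairmorph_im X f \<subseteq> pairmorph_im X g \<and> pairmorph_diag X f \<subseteq> pairmorph_diag X g"
    unfolding pairmorph_im_def pairmorph_diag_def
    using pairmorph_in[OF h] by (simp add: Id_on_subset_Times)
next
  assume sub: "pairmorph_im X f \<subseteq> pairmorph_im X g \<and> pairmorph_diag X f \<subseteq> pairmorph_diag X g"
  have "\<exists>q\<in>X \<times> X. pairmorph g q = pairmorph f p \<and> (p \<in> Id_on X \<longrightarrow> q \<in> Id_on X)"
    if "p \<in> X \<times> X" for p
  proof (cases "p \<in> Id_on X")
    case True
    then have "pairmorph f p \<in> pairmorph_diag X g"
      using sub by (auto simp: pairmorph_diag_def)
    then obtain q where "q \<in> Id_on X" "pairmorph g q = pairmorph f p"
      unfolding pairmorph_diag_def by (metis imageE)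
    then show ?thesis by auto
  next
    case False
    then have "pairmorph f p \<in> pairmorph_im X g"
      using sub that by (auto simp: pairmorph_im_def)
    with False show ?thesis
      unfolding pairmorph_im_def by (metis imageE)
  qed
  then obtain c where c_all: "\<forall>p\<in>X \<times> X. c p \<in> X \<times> X \<and> pairmorph g (c p) = pairmorph f p
      \<and> (p \<in> Id_on X \<longrightarrow> c p \<in> Id_on X)"
    using bchoice[of "X \<times> X" "\<lambda>p q. q \<in> X \<times> X \<and> pairmorph g q = pairmorph f p
      \<and> (p \<in> Id_on X \<longrightarrow> q \<in> Id_on X)"] by blast
  have c: "c p \<in> X \<times> X" "pairmorph g (c p) = pairmorph f p" if "p \<in> X \<times> X" for p
    using c_all that by blast+
  have c_diag: "c (a, a) \<in> Id_on X" if "a \<in> X" for a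
    using c_all that by (simp add: Id_on_iff)
  \<comment> \<open>Totality and antisymmetry make \<open>r\<close> contain exactly one of
    \<open>(a, b)\<close> and \<open>(b, a)\<close> whenever \<open>a \<noteq> b\<close>.\<close>
  obtain r :: "'a rel" where "well_order_on UNIV r"
    using well_order_on[of UNIV] by (rule exE)
  then have r: "total r" "antisym r"
    by (auto simp: well_order_on_def linear_order_on_def partial_order_on_def)
  \<comment> \<open>For \<open>(a, b)\<close> in \<open>r\<close> with \<open>a \<noteq> b\<close>,
    the values \<open>h (a, b)\<close> and \<open>h (b, a)\<close> are the two coordinates of the
    one pair \<open>c (a, b)\<close>.\<close>
  define h where "h = (\<lambda>(a, b)\<in>X \<times> X. if (a, b) \<in> r then fst (c (a, b)) else snd (c (b, a)))"
  have h: "h \<in> binops X"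
    using c(1) by (auto simp: h_def binops_def mem_Times_iff)
  have swap: "pairmorph g (prod.swap q) = prod.swap (pairmorph g q)" for g :: "'a \<times> 'a \<Rightarrow> 'a" and q
    by (cases q) (simp add: pairmorph_def)
  have h_c: "pairmorph h (a, b) = (if (a, b) \<in> r then c (a, b) else prod.swap (c (b, a)))"
    if ab: "a \<in> X" "b \<in> X" for a b
  proof (cases "a = b")
    case True
    \<comment> \<open>The diagonal choice of \<open>c (a, a)\<close> is essential here: its
      coordinates agree, so both branches of \<open>h\<close> give \<open>d\<close>.\<close>
    obtain d where "c (a, a) = (d, d)"
      using c_diag[OF ab(1)] by auto
    with True ab show ?thesis by (simp add: pairmorph_def h_def)
  next
    case False
    then have "(b, a) \<in> r \<longleftrightarrow> (a, b) \<notin> r"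
      using r by (auto simp: total_on_def dest: antisymD)
    with ab show ?thesis by (auto simp: pairmorph_def h_def prod_eq_iff)
  qed
  \<comment> \<open>If \<open>(a, b)\<close> is not in \<open>r\<close>, the equation for
    \<open>c (b, a)\<close> is carried over by \<open>swap\<close>, applied to both \<open>g\<close>
    and \<open>f\<close>.\<close>
  have "pairmorph g (pairmorph h (a, b)) = pairmorph f (a, b)" if "a \<in> X" "b \<in> X" for a b
    using that c(2)[of "(a, b)"] c(2)[of "(b, a)"] swap[of g] swap[of f "(b, a)"]
    by (simp add: h_c)
  \<comment> \<open>Compare first coordinates.\<close>
  then have "f (a, b) = op_mult X h g (a, b)" if "a \<in> X" "b \<in> X" for a b
    using that by (auto simp: pairmorph_def op_mult_def)
  moreover have "f \<in> extensional (X \<times> X)" "op_mult X h g \<in> extensional (X \<times> X)"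
    using f by (auto simp: binops_def PiE_iff op_mult_def)
  ultimately have "f = op_mult X h g"
    by (intro extensionalityI[of f "X \<times> X"]) auto
  with h show "\<exists>h\<in>binops X. f = op_mult X h g" by blast
qed

theorem corollary5:
  fixes X :: "'a set" and f g :: "'a \<times> 'a \<Rightarrow> 'a"
  assumes "finite X"
    and "f \<in> carrier (binop_monoid X)" and "g \<in> carrier (binop_monoid X)"
  shows "green_L (binop_monoid X) f g \<longleftrightarrow>
    pairmorph_im X f = pairmorph_im X g \<and> pairmorph_diag X f = pairmorph_diag X g"
proof -
  interpret monoid "binop_monoid X" by (rule monoid_binop_monoid)
  have "principal_left_ideal (binop_monoid X) u \<subseteq> principal_left_ideal (binop_monoid X) v \<longleftrightarrow>
      pairmorph_im X u \<subseteq> pairmorph_im X v \<and> pairmorph_diag X u \<subseteq> pairmorph_diag X v"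
    if "u \<in> carrier (binop_monoid X)" "v \<in> carrier (binop_monoid X)" for u v
  proof -
    have "u \<in> principal_left_ideal (binop_monoid X) v \<longleftrightarrow> (\<exists>h\<in>binops X. u = op_mult X h v)"
      by (auto simp: principal_left_ideal_def binop_monoid_def)
    moreover have "u \<in> binops X"
      using that(1) by (simp add: binop_monoid_def)
    ultimately show ?thesis
      using principal_left_ideal_subset_iff[OF that] left_multiple_iff by metis
  qed
  with assms(2,3) show ?thesis
    unfolding green_L_def set_eq_subset by blast
qed

end
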